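(* Let $S$ be a non-empty set and let $\Lambda = (X,f,x_0)$ be a minimal $\mathcal{L}_S$-algebra. Then there exists a $\Lambda$-compatible monoid operation (which is then unique) if and only if there exists a reflection $f'$ of $f$ in $\Lambda$.
   Context: $S$ is a fixed non-empty set. An $\mathcal{L}_S$-algebra is a triple $(X,f,x_0)$ with $X$ a non-empty set, $f : S \times X \to X$ a mapping and $x_0 \in X$; for $s\in S$ write $f_s : X \to X$, $f_s(x) = f(s,x)$. A subset $X' \subset X$ is $f$-invariant if $f_s(X') \subset X'$ for every $s \in S$. The algebra $(X,f,x_0)$ is minimal if the only $f$-invariant subset of $X$ containing $x_0$ is $X$ itself. A monoid operation on $(X,x_0)$ is an associative binary operation $\bullet$ on $X$ with $x \bullet x_0 = x_0 \bullet x = x$ for all $x \in X$. Given a monoid operation $\bullet$ on $(X,x_0)$, a mapping $u : X \to X$ is a translation in $(X,\bullet,x_0)$ if $u(x) = u(x_0) \bullet x$ for all $x \in X$. For an $\mathcal{L}_S$-algebra $\Lambda=(X,f,x_0)$, a monoid operation $\bullet$ on $(X,x_0)$ is $\Lambda$-compatible if $f_s$ is a translation in $(X,\bullet,x_0)$ for each $s \in S$. A reflection of $f$ in $\Lambda$ is a mapping $f' : S \times X \to X$ (with $f'_s(x) = f'(s,x)$) such that $f'_s(x_0) = f_s(x_0)$ for all $s \in S$ and $f'_s \circ f_t = f_t \circ f'_s$ for all $s,t \in S$. *)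

theory Defs
  imports "HOL-Algebra.Group"
begin

text \<open>
  All structures live on explicit carrier sets \<open>S\<close> and \<open>X\<close>. A map \<open>S \<times> X \<rightarrow> X\<close> is an
  element of \<open>S \<times> X \<rightarrow> X\<close> in the sense of \<open>Pi\<close>: only its values on the carrier matter, and
  equality of maps means agreement on the carrier.
\<close>

definition LS_algebra :: "'s set \<Rightarrow> 'a set \<Rightarrow> ('s \<times> 'a \<Rightarrow> 'a) \<Rightarrow> 'a \<Rightarrow> bool" where
  "LS_algebra S X f x0 \<longleftrightarrow> X \<noteq> {} \<and> f \<in> S \<times> X \<rightarrow> X \<and> x0 \<in> X"

definition invariant_subset :: "'s set \<Rightarrow> 'a set \<Rightarrow> ('s \<times> 'a \<Rightarrow> 'a) \<Rightarrow> 'a set \<Rightarrow> bool" where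
  "invariant_subset S X f X' \<longleftrightarrow> X' \<subseteq> X \<and> (\<forall>s\<in>S. (\<lambda>x. f (s, x)) ` X' \<subseteq> X')"

definition minimal_LS_algebra :: "'s set \<Rightarrow> 'a set \<Rightarrow> ('s \<times> 'a \<Rightarrow> 'a) \<Rightarrow> 'a \<Rightarrow> bool" where
  "minimal_LS_algebra S X f x0 \<longleftrightarrow>
     LS_algebra S X f x0 \<and> (\<forall>X'. invariant_subset S X f X' \<and> x0 \<in> X' \<longrightarrow> X' = X)"

definition monoid_operation :: "'a set \<Rightarrow> 'a \<Rightarrow> ('a \<Rightarrow> 'a \<Rightarrow> 'a) \<Rightarrow> bool" where
  "monoid_operation X x0 m \<longleftrightarrow> monoid \<lparr>carrier = X, mult = m, one = x0\<rparr>"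

definition translation :: "'a set \<Rightarrow> ('a \<Rightarrow> 'a \<Rightarrow> 'a) \<Rightarrow> 'a \<Rightarrow> ('a \<Rightarrow> 'a) \<Rightarrow> bool" where
  "translation X m x0 u \<longleftrightarrow> u \<in> X \<rightarrow> X \<and> (\<forall>x\<in>X. u x = m (u x0) x)"

definition compatible_monoid_operation ::
    "'s set \<Rightarrow> 'a set \<Rightarrow> ('s \<times> 'a \<Rightarrow> 'a) \<Rightarrow> 'a \<Rightarrow> ('a \<Rightarrow> 'a \<Rightarrow> 'a) \<Rightarrow> bool" where
  "compatible_monoid_operation S X f x0 m \<longleftrightarrow>
     monoid_operation X x0 m \<and> (\<forall>s\<in>S. translation X m x0 (\<lambda>x. f (s, x)))"

definition reflection ::
    "'s set \<Rightarrow> 'a set \<Rightarrow> ('s \<times> 'a \<Rightarrow> 'a) \<Rightarrow> 'a \<Rightarrow> ('s \<times> 'a \<Rightarrow> 'a) \<Rightarrow> bool" where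
  "reflection S X f x0 f' \<longleftrightarrow>
     f' \<in> S \<times> X \<rightarrow> X \<and>
     (\<forall>s\<in>S. f' (s, x0) = f (s, x0)) \<and>
     (\<forall>s\<in>S. \<forall>t\<in>S. \<forall>x\<in>X. f' (s, f (t, x)) = f (t, f' (s, x)))"

end

theory Submission imports Defs begin

text \<open>
  By minimality, a self-map of \<open>X\<close> commuting with every \<open>f\<^sub>s\<close> is determined by its value at \<open>x0\<close>.
  For a compatible operation the right multiplications are such maps, which gives uniqueness, and
  right multiplication by \<open>f\<^sub>s(x0)\<close> is a reflection. Conversely, a reflection yields for every
  \<open>x\<close> a commuting map \<open>u\<^sub>x\<close> with \<open>u\<^sub>x(x0) = x\<close>, since \<open>u\<^sub>x \<circ> f'\<^sub>s\<close> sends \<open>x0\<close> to \<open>f\<^sub>s(x)\<close>; then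
  \<open>x \<bullet> y = u\<^sub>y(x)\<close> is the required operation.
\<close>

lemma minimal_LS_algebraD:
  assumes "minimal_LS_algebra S X f x0"
  shows "x0 \<in> X" and "s \<in> S \<Longrightarrow> x \<in> X \<Longrightarrow> f (s, x) \<in> X"
  using assms by (auto simp: minimal_LS_algebra_def LS_algebra_def)

text \<open>Minimality as structural induction: the points satisfying \<open>P\<close> form an
  invariant subset containing \<open>x0\<close>.\<close>

lemma minimal_LS_algebra_induct [consumes 2, case_names base step]:
  assumes "minimal_LS_algebra S X f x0" and "x \<in> X"
    and "P x0" and "\<And>s x. s \<in> S \<Longrightarrow> x \<in> X \<Longrightarrow> P x \<Longrightarrow> P (f (s, x))"
  shows "P x"
proof -
  have "invariant_subset S X f {x \<in> X. P x}"
    using assms by (auto simp: invariant_subset_def minimal_LS_algebraD(2))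
  moreover have "x0 \<in> {x \<in> X. P x}"
    using assms(3) minimal_LS_algebraD(1)[OF assms(1)] by simp
  ultimately have "{x \<in> X. P x} = X"
    using assms(1) by (auto simp: minimal_LS_algebra_def)
  then show ?thesis using assms(2) by auto
qed

text \<open>These are the endomorphisms of \<open>(X, f)\<close> with the base point forgotten;
  values outside \<open>X\<close> are unconstrained.\<close>

definition commuting_maps :: "'s set \<Rightarrow> 'a set \<Rightarrow> ('s \<times> 'a \<Rightarrow> 'a) \<Rightarrow> ('a \<Rightarrow> 'a) set" where
  "commuting_maps S X f = {u \<in> X \<rightarrow> X. \<forall>s\<in>S. \<forall>x\<in>X. u (f (s, x)) = f (s, u x)}"

lemma commuting_mapsD:
  assumes "u \<in> commuting_maps S X f" and "x \<in> X"
  shows "u x \<in> X" and "s \<in> S \<Longrightarrow> u (f (s, x)) = f (s, u x)"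
  using assms by (auto simp: commuting_maps_def)

lemma id_in_commuting_maps: "(\<lambda>x. x) \<in> commuting_maps S X f"
  by (simp add: commuting_maps_def)

lemma comp_in_commuting_maps:
  assumes "u \<in> commuting_maps S X f" and "v \<in> commuting_maps S X f"
  shows "(\<lambda>x. u (v x)) \<in> commuting_maps S X f"
  using assms by (auto simp: commuting_maps_def Pi_iff)

lemma commuting_maps_eqI:
  assumes "minimal_LS_algebra S X f x0"
    and "u \<in> commuting_maps S X f" and "v \<in> commuting_maps S X f"
    and "u x0 = v x0" and "x \<in> X"
  shows "u x = v x"
  using assms(1,5)
proof (induction rule: minimal_LS_algebra_induct)
  case base
  show ?case by fact
next
  case (step s x)
  then show ?case using assms(2,3) by (simp add: commuting_mapsD(2))
qed

lemma compatible_monoid_operationD: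
  assumes "compatible_monoid_operation S X f x0 m"
  shows "x \<in> X \<Longrightarrow> y \<in> X \<Longrightarrow> m x y \<in> X"
    and "x \<in> X \<Longrightarrow> y \<in> X \<Longrightarrow> z \<in> X \<Longrightarrow> m (m x y) z = m x (m y z)"
    and "x \<in> X \<Longrightarrow> m x0 x = x"
    and "s \<in> S \<Longrightarrow> x \<in> X \<Longrightarrow> f (s, x) = m (f (s, x0)) x"
proof -
  interpret monoid "\<lparr>carrier = X, mult = m, one = x0\<rparr>"
    using assms by (simp add: compatible_monoid_operation_def monoid_operation_def)
  show "x \<in> X \<Longrightarrow> y \<in> X \<Longrightarrow> m x y \<in> X" using m_closed by simp
  show "x \<in> X \<Longrightarrow> y \<in> X \<Longrightarrow> z \<in> X \<Longrightarrow> m (m x y) z = m x (m y z)" using m_assoc by simp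
  show "x \<in> X \<Longrightarrow> m x0 x = x" using l_one by simp
  show "s \<in> S \<Longrightarrow> x \<in> X \<Longrightarrow> f (s, x) = m (f (s, x0)) x"
    using assms by (simp add: compatible_monoid_operation_def translation_def)
qed

text \<open>Each \<open>f_s\<close> is left multiplication by \<open>f (s, x0)\<close>, and
  associativity makes left and right multiplications commute.\<close>

lemma right_mult_in_commuting_maps:
  assumes "minimal_LS_algebra S X f x0" and "compatible_monoid_operation S X f x0 m"
    and "y \<in> X"
  shows "(\<lambda>x. m x y) \<in> commuting_maps S X f"
proof -
  note D = compatible_monoid_operationD[OF assms(2)]
  note [simp] = minimal_LS_algebraD[OF assms(1)]
  have "m (f (s, x)) y = f (s, m x y)" if "s \<in> S" "x \<in> X" for s x
  proof -
    have "m (f (s, x)) y = m (m (f (s, x0)) x) y" using D(4)[OF that] by simp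
    also have "\<dots> = m (f (s, x0)) (m x y)" using D(2) that assms(3) by simp
    also have "\<dots> = f (s, m x y)" using D(4)[of s "m x y"] D(1) that assms(3) by simp
    finally show ?thesis .
  qed
  then show ?thesis using D(1) assms(3) by (simp add: commuting_maps_def)
qed

text \<open>By the left unit law, right multiplication by \<open>y\<close> sends \<open>x0\<close>
  to \<open>y\<close> under both operations.\<close>

lemma compatible_monoid_operation_unique:
  assumes "minimal_LS_algebra S X f x0"
    and "compatible_monoid_operation S X f x0 m" and "compatible_monoid_operation S X f x0 m'"
    and "x \<in> X" and "y \<in> X"
  shows "m x y = m' x y"
  using commuting_maps_eqI[OF assms(1) right_mult_in_commuting_maps[OF assms(1,2,5)]
      right_mult_in_commuting_maps[OF assms(1,3,5)] _ assms(4)]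
    compatible_monoid_operationD(3)[OF assms(2,5)] compatible_monoid_operationD(3)[OF assms(3,5)]
  by simp

lemma compatible_monoid_operation_imp_reflection:
  assumes "minimal_LS_algebra S X f x0" and "compatible_monoid_operation S X f x0 m"
  shows "reflection S X f x0 (\<lambda>(s, x). m x (f (s, x0)))"
  using commuting_mapsD[OF right_mult_in_commuting_maps[OF assms]]
    compatible_monoid_operationD(3)[OF assms(2)] minimal_LS_algebraD[OF assms(1)]
  by (auto simp: reflection_def)

lemma ex_commuting_map:
  assumes "minimal_LS_algebra S X f x0" and "reflection S X f x0 f'" and "x \<in> X"
  shows "\<exists>u\<in>commuting_maps S X f. u x0 = x"
  using assms(1,3)
proof (induction rule: minimal_LS_algebra_induct)
  case base
  show ?case using id_in_commuting_maps by fast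
next
  case (step s x)
  then obtain u where u: "u \<in> commuting_maps S X f" "u x0 = x" by blast
  \<comment> \<open>The exchange law of a reflection says exactly that \<open>f'_s\<close> commutes
    with every \<open>f_t\<close>.\<close>
  have "(\<lambda>x. f' (s, x)) \<in> commuting_maps S X f"
    using assms(2) \<open>s \<in> S\<close> by (auto simp: reflection_def commuting_maps_def)
  then have "(\<lambda>x. u (f' (s, x))) \<in> commuting_maps S X f"
    by (rule comp_in_commuting_maps[OF u(1)])
  \<comment> \<open>Since \<open>f'\<close> agrees with \<open>f\<close> at \<open>x0\<close>, the
    left side is \<open>u (f (s, x0)) = f (s, u x0)\<close>.\<close>
  moreover have "u (f' (s, x0)) = f (s, x)"
    using assms(2) \<open>s \<in> S\<close> u commuting_mapsD(2)[OF u(1) minimal_LS_algebraD(1)[OF assms(1)]]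
    by (simp add: reflection_def)
  ultimately show ?case by (intro bexI[of _ "\<lambda>x. u (f' (s, x))"])
qed

lemma reflection_imp_compatible_monoid_operation:
  assumes "minimal_LS_algebra S X f x0" and "reflection S X f x0 f'"
  obtains m where "compatible_monoid_operation S X f x0 m"
proof -
  note X = minimal_LS_algebraD[OF assms(1)]
  obtain u where u: "\<And>x. x \<in> X \<Longrightarrow> u x \<in> commuting_maps S X f" "\<And>x. x \<in> X \<Longrightarrow> u x x0 = x"
    using ex_commuting_map[OF assms] by metis
  have closed: "u y x \<in> X" if "x \<in> X" "y \<in> X" for x y
    using commuting_mapsD(1)[OF u(1)] that by blast
  \<comment> \<open>The right unit law: \<open>u y\<close> is to be right multiplication by
    \<open>y\<close>, and \<open>u x0\<close> agrees with the identity at \<open>x0\<close>.\<close>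
  have "u x0 x = x" if "x \<in> X" for x
    using commuting_maps_eqI[OF assms(1) u(1) id_in_commuting_maps _ that] u(2) X(1) by simp
  \<comment> \<open>Associativity: as maps of \<open>x\<close>, both sides commute with every
    \<open>f_s\<close> and send \<open>x0\<close> to \<open>u z y\<close>.\<close>
  moreover have "u z (u y x) = u (u z y) x" if "x \<in> X" "y \<in> X" "z \<in> X" for x y z
    using commuting_maps_eqI[OF assms(1) comp_in_commuting_maps[OF u(1) u(1)] u(1) _ that(1)]
      that closed u(2) by simp
  ultimately have "monoid_operation X x0 (\<lambda>x y. u y x)"
    unfolding monoid_operation_def by unfold_locales (simp_all add: closed u(2) X(1))
  \<comment> \<open>Here \<open>x = u x x0\<close>, and \<open>u x\<close> is moved past
    \<open>f_s\<close>; this is the translation property.\<close>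
  moreover have "f (s, x) = u x (f (s, x0))" if "s \<in> S" "x \<in> X" for s x
    using commuting_mapsD(2)[OF u(1) X(1)] u(2) that by simp
  ultimately have "compatible_monoid_operation S X f x0 (\<lambda>x y. u y x)"
    using X(2) by (simp add: compatible_monoid_operation_def translation_def)
  then show thesis by (rule that)
qed

theorem theorem1p1:
  fixes S :: "'s set" and X :: "'a set" and f :: "'s \<times> 'a \<Rightarrow> 'a" and x0 :: 'a
  assumes "S \<noteq> {}"
    and "minimal_LS_algebra S X f x0"
  shows "((\<exists>m. compatible_monoid_operation S X f x0 m) \<longleftrightarrow> (\<exists>f'. reflection S X f x0 f')) \<and>
    (\<forall>m m'. compatible_monoid_operation S X f x0 m \<and> compatible_monoid_operation S X f x0 m'
       \<longrightarrow> (\<forall>x\<in>X. \<forall>y\<in>X. m x y = m' x y))"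
  using compatible_monoid_operation_imp_reflection[OF assms(2)]
    reflection_imp_compatible_monoid_operation[OF assms(2)]
    compatible_monoid_operation_unique[OF assms(2)]
  by meson

end
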